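(* Let $\alpha>0$, let $G$ be an arbitrary weighted multigraph, let $i$ and $j$ be distinct vertices of $G$, and let $\varepsilon_{ij}$ be the total weight of all edges of $G$ with terminal vertices $i$ and $j$. Let $\theta_{ij}$ be the cumulative weight of connections between $i$ and $j$ in $G$. Then: 1. $\theta_{ij}=\theta^0_{ij}+\varepsilon_{ij}$, where $\theta^0_{ij}$ is the cumulative weight of connections between $i$ and $j$ in the multigraph resulting from $G$ by the removal of all edges with terminal vertices $i$ and $j$. 2. $\theta_{ij}\ge\varepsilon_{ij}$. 3. $\theta_{ij}=\varepsilon_{ij}$ if and only if $i$ and $j$ are not connected with the other vertices of $G$ (but they can be connected to each other), i.e., no edge of $G$ joins a vertex of $\{i,j\}$ to a vertex outside $\{i,j\}$.
   Context: A weighted multigraph $G$ has finite vertex set $V(G)=\{1,\ldots,n\}$; multiple edges are allowed, loops are not, and all edge weights are strictly positive. Its Laplacian matrix $L=L(G)=(\ell_{ij})$ is given by: for $j\ne i$, $\ell_{ij}$ is minus the sum of the weights of all edges with terminal vertices $i$ and $j$; and $\ell_{ii}=-\sum_{j\neq i}\ell_{ij}$. For a fixed parameter $\alpha>0$, the relative forest accessibility matrix is $Q=(q_{ij})=(I+\alpha L)^{-1}$, and the adjusted forest distance is $\rho_{ij}=\alpha(q_{ii}+q_{jj}-q_{ij}-q_{ji})$ (this is a metric on $V(G)$). For distinct vertices $i$ and $j$, the cumulative weight of connections between $i$ and $j$ in $G$ is $\theta_{ij}=(\rho_{ij})^{-1}-(2\alpha)^{-1}$. An empty sum of edge weights is $0$.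 *)

theory Defs
  imports "HOL-Analysis.Analysis"
begin

text \<open>
  The vertex set is a finite type \<open>'n\<close>, standing for \<open>{1, \<dots>, n}\<close> with \<open>n = CARD('n)\<close>.
  Edges have identities of their own (type \<open>'e\<close>), so parallel edges, also of equal weight,
  are possible; each edge is mapped to the set of its terminal vertices.
\<close>

record ('n, 'e) wmultigraph =
  edges :: "'e set"
  ends :: "'e \<Rightarrow> 'n set"
  weight :: "'e \<Rightarrow> real"

text \<open>The cardinality condition excludes loops.\<close>

definition weighted_multigraph :: "('n::finite, 'e) wmultigraph \<Rightarrow> bool" where
  "weighted_multigraph G \<longleftrightarrow>
     finite (edges G) \<and>
     (\<forall>e\<in>edges G. card (ends G e) = 2) \<and>
     (\<forall>e\<in>edges G. weight G e > 0)"

definition edges_between :: "('n::finite, 'e) wmultigraph \<Rightarrow> 'n \<Rightarrow> 'n \<Rightarrow> 'e set" where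
  "edges_between G i j = {e \<in> edges G. ends G e = {i, j}}"

definition total_weight :: "('n::finite, 'e) wmultigraph \<Rightarrow> 'n \<Rightarrow> 'n \<Rightarrow> real" where
  "total_weight G i j = (\<Sum>e\<in>edges_between G i j. weight G e)"

definition laplacian :: "('n::finite, 'e) wmultigraph \<Rightarrow> real^'n^'n" where
  "laplacian G =
     (\<chi> i j. if j \<noteq> i then - total_weight G i j
             else - (\<Sum>k\<in>UNIV - {i}. - total_weight G i k))"

definition forest_accessibility :: "real \<Rightarrow> ('n::finite, 'e) wmultigraph \<Rightarrow> real^'n^'n" where
  "forest_accessibility \<alpha> G = matrix_inv (mat 1 + \<alpha> *\<^sub>R laplacian G)"

definition adjusted_forest_distance :: "real \<Rightarrow> ('n::finite, 'e) wmultigraph \<Rightarrow> 'n \<Rightarrow> 'n \<Rightarrow> real" where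
  "adjusted_forest_distance \<alpha> G i j =
     (let Q = forest_accessibility \<alpha> G
      in \<alpha> * (Q $ i $ i + Q $ j $ j - Q $ i $ j - Q $ j $ i))"

definition cumulative_weight :: "real \<Rightarrow> ('n::finite, 'e) wmultigraph \<Rightarrow> 'n \<Rightarrow> 'n \<Rightarrow> real" where
  "cumulative_weight \<alpha> G i j = inverse (adjusted_forest_distance \<alpha> G i j) - inverse (2 * \<alpha>)"

definition remove_edges_between ::
  "('n::finite, 'e) wmultigraph \<Rightarrow> 'n \<Rightarrow> 'n \<Rightarrow> ('n, 'e) wmultigraph" where
  "remove_edges_between G i j = G\<lparr>edges := edges G - edges_between G i j\<rparr>"

end

theory Submission
  imports Defs
begin

text \<open>
  Write \<open>A = I + \<alpha> L\<close>, \<open>d = e\<^sub>i - e\<^sub>j\<close>, and let \<open>x\<close> solve \<open>A x = d\<close>, so that the adjusted forest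
  distance is \<open>\<alpha> s\<close> with \<open>s = d \<bullet> x\<close>. The edges between \<open>i\<close> and \<open>j\<close> contribute the rank-one
  term \<open>\<epsilon> d d\<^sup>T\<close> to \<open>L\<close>; hence restoring them divides the solution \<open>x\<close> by \<open>1 + \<alpha> \<epsilon> s\<close> and adds
  \<open>\<epsilon>\<close> to \<open>1 / (\<alpha> s)\<close>. Since \<open>L\<close> is positive semidefinite, \<open>s = x \<bullet> A x \<ge> x \<bullet> x\<close>, and so
  \<open>2 - s = \<parallel>d - x\<parallel>\<^sup>2 + (s - \<parallel>x\<parallel>\<^sup>2) \<ge> 0\<close>, with equality only if \<open>x = d\<close>, that is, \<open>L d = 0\<close>.
\<close>

section \<open>Total weights between pairs of vertices\<close>

lemma total_weight_commute: "total_weight G i j = total_weight G j i"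
  by (simp add: total_weight_def edges_between_def insert_commute)

lemma total_weight_nonneg:
  assumes "weighted_multigraph G"
  shows "0 \<le> total_weight G i j"
  using assms unfolding total_weight_def edges_between_def weighted_multigraph_def
  by (intro sum_nonneg) (auto intro: less_imp_le)

lemma total_weight_eq_0_iff:
  assumes "weighted_multigraph G"
  shows "total_weight G i j = 0 \<longleftrightarrow> edges_between G i j = {}"
proof -
  have "finite (edges_between G i j)" and pos: "\<And>e. e \<in> edges_between G i j \<Longrightarrow> weight G e > 0"
    using assms by (auto simp: weighted_multigraph_def edges_between_def)
  then have "total_weight G i j = 0 \<longleftrightarrow> (\<forall>e\<in>edges_between G i j. weight G e = 0)"
    unfolding total_weight_def by (intro sum_nonneg_eq_0_iff) (auto intro: less_imp_le)
  with pos show ?thesis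
    by force
qed

lemma total_weight_self:
  assumes "weighted_multigraph G"
  shows "total_weight G i i = 0"
  using assms
  by (auto simp: total_weight_eq_0_iff edges_between_def weighted_multigraph_def)

section \<open>The Laplacian as a difference operator and its quadratic form\<close>

lemma laplacian_mult_nth:
  assumes "weighted_multigraph G"
  shows "(laplacian G *v x) $ u = (\<Sum>v\<in>UNIV. total_weight G u v * (x $ u - x $ v))"
proof -
  have "(laplacian G *v x) $ u
      = laplacian G $ u $ u * x $ u + (\<Sum>v\<in>UNIV - {u}. laplacian G $ u $ v * x $ v)"
    unfolding matrix_vector_mult_def by (simp add: sum.remove[of UNIV u])
  also have "(\<Sum>v\<in>UNIV - {u}. laplacian G $ u $ v * x $ v)
      = (\<Sum>v\<in>UNIV - {u}. - total_weight G u v * x $ v)"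
    by (rule sum.cong) (auto simp: laplacian_def)
  also have "laplacian G $ u $ u * x $ u = (\<Sum>v\<in>UNIV - {u}. total_weight G u v * x $ u)"
    by (simp add: laplacian_def sum_negf sum_distrib_right)
  also have "\<dots> + (\<Sum>v\<in>UNIV - {u}. - total_weight G u v * x $ v)
      = (\<Sum>v\<in>UNIV - {u}. total_weight G u v * (x $ u - x $ v))"
    by (simp add: sum.distrib[symmetric] algebra_simps)
  \<comment> \<open>The added term \<open>v = u\<close> contains the factor
    \<open>x $ u - x $ u\<close>.\<close>
  also have "\<dots> = (\<Sum>v\<in>UNIV. total_weight G u v * (x $ u - x $ v))"
    by (simp add: sum.remove[of UNIV u])
  finally show ?thesis .
qed

text \<open>Exchanging \<open>u\<close> and \<open>v\<close> and using the symmetry of the weights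
  gives a second form of the double sum; adding the two completes the square. The factor 2 reflects
  that each unordered pair is counted twice.\<close>

lemma laplacian_quadratic_form:
  assumes "weighted_multigraph G"
  shows "2 * (x \<bullet> (laplacian G *v x))
    = (\<Sum>u\<in>UNIV. \<Sum>v\<in>UNIV. total_weight G u v * (x $ u - x $ v)\<^sup>2)"
proof -
  let ?w = "total_weight G"
  have 1: "x \<bullet> (laplacian G *v x) = (\<Sum>u\<in>UNIV. \<Sum>v\<in>UNIV. ?w u v * (x $ u * (x $ u - x $ v)))"
    by (simp add: inner_vec_def laplacian_mult_nth[OF assms] sum_distrib_left mult_ac)
  also have "\<dots> = (\<Sum>u\<in>UNIV. \<Sum>v\<in>UNIV. ?w u v * (x $ v * (x $ v - x $ u)))"
    by (subst sum.swap) (simp add: total_weight_commute)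
  finally have 2: "x \<bullet> (laplacian G *v x)
      = (\<Sum>u\<in>UNIV. \<Sum>v\<in>UNIV. ?w u v * (x $ v * (x $ v - x $ u)))" .
  show ?thesis
    unfolding mult_2 by (subst 1, subst 2)
      (simp add: sum.distrib[symmetric] power2_eq_square algebra_simps)
qed

lemma laplacian_psd:
  assumes "weighted_multigraph G"
  shows "0 \<le> x \<bullet> (laplacian G *v x)"
proof -
  have "0 \<le> 2 * (x \<bullet> (laplacian G *v x))"
    unfolding laplacian_quadratic_form[OF assms]
    by (intro sum_nonneg mult_nonneg_nonneg total_weight_nonneg assms) simp
  then show ?thesis
    by simp
qed

section \<open>The matrix I + \<alpha> L and its inverse\<close>

lemma forest_matrix_mult:
  "(mat 1 + \<alpha> *\<^sub>R laplacian G) *v x = x + \<alpha> *\<^sub>R (laplacian G *v x)"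
  by (simp add: matrix_vector_mult_add_rdistrib scaleR_matrix_vector_assoc[symmetric])

lemma forest_matrix_coercive:
  assumes "\<alpha> > 0" and "weighted_multigraph G"
  shows "x \<bullet> x \<le> x \<bullet> ((mat 1 + \<alpha> *\<^sub>R laplacian G) *v x)"
  using assms laplacian_psd[OF assms(2), of x]
  by (simp add: forest_matrix_mult inner_add_right)

text \<open>Coercivity makes the kernel trivial, which suffices for a square matrix to be
  invertible.\<close>

lemma forest_matrix_inverse:
  assumes "\<alpha> > 0" and "weighted_multigraph G"
  shows "forest_accessibility \<alpha> G ** (mat 1 + \<alpha> *\<^sub>R laplacian G) = mat 1"
    and "(mat 1 + \<alpha> *\<^sub>R laplacian G) ** forest_accessibility \<alpha> G = mat 1"
proof -
  let ?A = "mat 1 + \<alpha> *\<^sub>R laplacian G"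
  have "x = 0" if "?A *v x = 0" for x
    using forest_matrix_coercive[OF assms, of x] that
    by (metis inner_eq_zero_iff inner_ge_zero inner_zero_right order_antisym)
  then have "invertible ?A"
    by (metis invertible_left_inverse matrix_left_invertible_ker)
  \<comment> \<open>\<open>matrix_inv\<close> is a choice of two-sided inverse, so its properties
    follow once one exists.\<close>
  then have "?A ** matrix_inv ?A = mat 1 \<and> matrix_inv ?A ** ?A = mat 1"
    unfolding invertible_def matrix_inv_def by (rule someI_ex)
  then show "forest_accessibility \<alpha> G ** ?A = mat 1" "?A ** forest_accessibility \<alpha> G = mat 1"
    by (simp_all add: forest_accessibility_def)
qed

section \<open>The forest distance through the solution of A x = d\<close>

lemma forest_matrix_solution:
  assumes "\<alpha> > 0" and "weighted_multigraph G"
  obtains x where "(mat 1 + \<alpha> *\<^sub>R laplacian G) *v x = d"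
  using forest_matrix_inverse(2)[OF assms] by (metis matrix_vector_mul_assoc matrix_vector_mul_lid)

text \<open>The solution is column \<open>i\<close> minus column \<open>j\<close> of Q, so
  \<open>x $ i - x $ j\<close> collects exactly the four entries of Q in the distance.\<close>

lemma adjusted_forest_distance_eq:
  assumes "\<alpha> > 0" and "weighted_multigraph G"
    and x: "(mat 1 + \<alpha> *\<^sub>R laplacian G) *v x = axis i 1 - axis j 1"
  shows "adjusted_forest_distance \<alpha> G i j = \<alpha> * (x $ i - x $ j)"
proof -
  let ?Q = "forest_accessibility \<alpha> G"
  have "x = ?Q *v (axis i 1 - axis j 1)"
    unfolding x[symmetric] matrix_vector_mul_assoc
    by (simp add: forest_matrix_inverse(1)[OF assms(1,2)])
  then have "x = column i ?Q - column j ?Q"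
    by (simp add: matrix_vector_mult_diff_distrib matrix_vector_mult_basis)
  then show ?thesis
    by (simp add: adjusted_forest_distance_def Let_def column_def)
qed

lemma inner_axis_diff: "(axis i 1 - axis j 1) \<bullet> (x :: real^'n) = x $ i - x $ j"
  by (simp add: inner_diff_left inner_axis')

lemma forest_solution_bounds:
  assumes "\<alpha> > 0" and "weighted_multigraph G" and "i \<noteq> j"
    and x: "(mat 1 + \<alpha> *\<^sub>R laplacian G) *v x = axis i 1 - axis j 1"
  shows "0 < x $ i - x $ j" and "x $ i - x $ j \<le> 2"
    and "x $ i - x $ j = 2 \<longleftrightarrow> laplacian G *v (axis i 1 - axis j 1) = 0"
proof -
  define d :: "real^'a" where "d = axis i 1 - axis j 1"
  define s where "s = x $ i - x $ j"
  have dx: "d \<bullet> x = s"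
    by (simp add: d_def s_def inner_axis_diff)
  have dd: "d \<bullet> d = 2"
    using assms(3) unfolding d_def inner_axis_diff by (simp add: axis_def)
  \<comment> \<open>Since A x = d, the form x \<bullet> A x in the coercivity bound equals
    s.\<close>
  have xs: "x \<bullet> x \<le> s"
    using forest_matrix_coercive[OF assms(1,2), of x] dx by (simp add: x d_def[symmetric] inner_commute)
  have "x \<noteq> 0"
  proof
    assume "x = 0"
    with x have "d = 0" by (simp add: d_def)
    with dd show False by simp
  qed
  with xs show "0 < x $ i - x $ j"
    by (metis inner_gt_zero_iff less_le_trans s_def)
  have gap: "2 - s = (d - x) \<bullet> (d - x) + (s - x \<bullet> x)"
    by (simp add: inner_diff_left inner_diff_right dd dx inner_commute[of x d])
  with xs inner_ge_zero[of "d - x"] show "x $ i - x $ j \<le> 2"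
    unfolding s_def[symmetric] by linarith
  have "s = 2 \<longleftrightarrow> x = d"
  proof
    assume "s = 2"
    with gap xs inner_ge_zero[of "d - x"] have "(d - x) \<bullet> (d - x) = 0"
      by linarith
    then show "x = d" by simp
  qed (use dx dd in simp)
  also have "x = d \<longleftrightarrow> laplacian G *v d = 0"
  proof
    assume "x = d"
    with x assms(1) show "laplacian G *v d = 0"
      by (simp add: forest_matrix_mult d_def)
  next
    assume "laplacian G *v d = 0"
    then have "(mat 1 + \<alpha> *\<^sub>R laplacian G) *v d = d"
      by (simp add: forest_matrix_mult)
    \<comment> \<open>Both vectors solve A y = d, and the left inverse of A makes the solution
      unique.\<close>
    with x show "x = d"
      by (metis d_def forest_matrix_inverse(1)[OF assms(1,2)] matrix_vector_mul_assoc
          matrix_vector_mul_lid)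
  qed
  finally show "x $ i - x $ j = 2 \<longleftrightarrow> laplacian G *v (axis i 1 - axis j 1) = 0"
    by (simp add: s_def d_def)
qed

text \<open>Rows \<open>i\<close> and \<open>j\<close> of L d are sums whose terms all have one
  sign, so they vanish only termwise. Edges between \<open>i\<close> and \<open>j\<close> are
  excluded too; the final theorem applies this after their deletion.\<close>

lemma laplacian_axis_diff_eq_0_iff:
  assumes G: "weighted_multigraph G" and ij: "i \<noteq> j"
  shows "laplacian G *v (axis i 1 - axis j 1) = 0 \<longleftrightarrow>
    (\<forall>v. total_weight G i v = 0 \<and> total_weight G j v = 0)"
proof
  let ?d = "axis i 1 - axis j 1 :: real^'a"
  assume L: "laplacian G *v ?d = 0"
  have wi: "total_weight G i v * (1 - ?d $ v) = 0" for v
  proof -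
    have "(\<Sum>v\<in>UNIV. total_weight G i v * (1 - ?d $ v)) = 0"
      using arg_cong[OF L, of "\<lambda>y. y $ i"] ij
      unfolding laplacian_mult_nth[OF G] by (simp add: axis_def)
    then show ?thesis
      by (subst (asm) sum_nonneg_eq_0_iff)
        (auto simp: axis_def intro!: mult_nonneg_nonneg total_weight_nonneg G)
  qed
  have wj: "total_weight G j v * (1 + ?d $ v) = 0" for v
  proof -
    have "(\<Sum>v\<in>UNIV. total_weight G j v * (- 1 - ?d $ v)) = 0"
      using arg_cong[OF L, of "\<lambda>y. y $ j"] ij
      unfolding laplacian_mult_nth[OF G] by (simp add: axis_def)
    \<comment> \<open>The sign is flipped to make every term nonnegative.\<close>
    then have "(\<Sum>v\<in>UNIV. total_weight G j v * (1 + ?d $ v)) = 0"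
      by (simp add: algebra_simps sum.distrib sum_subtractf sum_negf)
    then show ?thesis
      by (subst (asm) sum_nonneg_eq_0_iff)
        (auto simp: axis_def intro!: mult_nonneg_nonneg total_weight_nonneg G)
  qed
  show "\<forall>v. total_weight G i v = 0 \<and> total_weight G j v = 0"
  proof
    fix v
    show "total_weight G i v = 0 \<and> total_weight G j v = 0"
      \<comment> \<open>The factor 1 - d_v is zero only at \<open>v = i\<close>, and 1 + d_v only at
        \<open>v = j\<close>; the weights left over there belong to loops.\<close>
      using wi[of v] wj[of v] total_weight_self[OF G, of v] ij
      by (cases "v = i"; cases "v = j") (auto simp: axis_def total_weight_commute split: if_splits)
  qed
next
  assume w: "\<forall>v. total_weight G i v = 0 \<and> total_weight G j v = 0"
  have "(laplacian G *v (axis i 1 - axis j 1)) $ u = 0" for u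
    unfolding laplacian_mult_nth[OF G]
  proof (rule sum.neutral, rule ballI)
    fix v
    show "total_weight G u v * ((axis i 1 - axis j 1 :: real^'a) $ u - (axis i 1 - axis j 1) $ v) = 0"
      \<comment> \<open>Where d_u and d_v differ, \<open>u\<close> or \<open>v\<close> lies in
        \<open>{i, j}\<close>, so the weight is zero.\<close>
      using w total_weight_commute[of G u] by (auto simp: axis_def)
  qed
  then show "laplacian G *v (axis i 1 - axis j 1) = 0"
    by (simp add: vec_eq_iff)
qed

section \<open>Nonnegativity of the cumulative weight and its zero case\<close>

lemma cumulative_weight_nonneg:
  assumes "\<alpha> > 0" and "weighted_multigraph G" and "i \<noteq> j"
  shows "0 \<le> cumulative_weight \<alpha> G i j"
    and "cumulative_weight \<alpha> G i j = 0 \<longleftrightarrow>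
      (\<forall>v. total_weight G i v = 0 \<and> total_weight G j v = 0)"
proof -
  obtain x where x: "(mat 1 + \<alpha> *\<^sub>R laplacian G) *v x = axis i 1 - axis j 1"
    using forest_matrix_solution[OF assms(1,2)] .
  note b = forest_solution_bounds[OF assms x]
  \<comment> \<open>The cumulative weight is 1/(\<alpha> s) - 1/(2 \<alpha>), so 0 < s \<le> 2 gives
    the sign, and s = 2 is the zero case.\<close>
  show "0 \<le> cumulative_weight \<alpha> G i j"
    using assms(1) b(1,2) unfolding cumulative_weight_def adjusted_forest_distance_eq[OF assms(1,2) x]
    by (simp add: mult.commute[of 2] del: inverse_mult_distrib)
  have "cumulative_weight \<alpha> G i j = 0 \<longleftrightarrow> x $ i - x $ j = 2"
    using assms(1) b(1)
    unfolding cumulative_weight_def adjusted_forest_distance_eq[OF assms(1,2) x] eq_iff_diff_eq_0[symmetric]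
    by (auto simp: inverse_eq_iff_eq mult.commute[of 2] simp del: inverse_mult_distrib)
  also note b(3)
  also note laplacian_axis_diff_eq_0_iff[OF assms(2,3)]
  finally show "cumulative_weight \<alpha> G i j = 0 \<longleftrightarrow>
      (\<forall>v. total_weight G i v = 0 \<and> total_weight G j v = 0)" .
qed

section \<open>Deleting the edges between two vertices\<close>

lemma weighted_multigraph_remove_edges_between:
  "weighted_multigraph G \<Longrightarrow> weighted_multigraph (remove_edges_between G i j)"
  by (auto simp: weighted_multigraph_def remove_edges_between_def)

lemma edges_between_remove_edges_between:
  "edges_between (remove_edges_between G i j) u v
    = (if {u, v} = {i, j} then {} else edges_between G u v)"
  by (auto simp: edges_between_def remove_edges_between_def)

lemma total_weight_remove_edges_between:
  "total_weight (remove_edges_between G i j) u v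
    = (if {u, v} = {i, j} then 0 else total_weight G u v)"
  unfolding total_weight_def edges_between_remove_edges_between
  by (simp add: remove_edges_between_def)

text \<open>The rank-one update \<epsilon> d d^T applied to \<open>x\<close>, with d^T x =
  \<open>x $ i - x $ j\<close>.\<close>

lemma laplacian_remove_edges_between:
  assumes "weighted_multigraph G" and "i \<noteq> j"
  shows "laplacian G *v x = laplacian (remove_edges_between G i j) *v x
    + (total_weight G i j * (x $ i - x $ j)) *\<^sub>R (axis i 1 - axis j 1)"
proof -
  let ?H = "remove_edges_between G i j"
  define \<epsilon> where "\<epsilon> = total_weight G i j"
  \<comment> \<open>The pair \<open>{i, j}\<close> appears in two orders; as
    \<open>i \<noteq> j\<close>, at most one of the two corrections is active.\<close>
  have w: "total_weight G u v
      = total_weight ?H u v + ((if u = i \<and> v = j then \<epsilon> else 0) + (if u = j \<and> v = i then \<epsilon> else 0))"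
    for u v
    using assms(2) total_weight_commute[of G j i]
    by (auto simp: \<epsilon>_def total_weight_remove_edges_between doubleton_eq_iff)
  have "(laplacian G *v x) $ u = (laplacian ?H *v x) $ u
    + ((\<epsilon> * (x $ i - x $ j)) *\<^sub>R (axis i 1 - axis j 1)) $ u" for u
  proof -
    \<comment> \<open>Testing \<open>v\<close> outermost lets each sum collapse to a single
      term.\<close>
    have "(laplacian G *v x) $ u = (laplacian ?H *v x) $ u
      + ((\<Sum>v\<in>UNIV. if v = j then (if u = i then \<epsilon> * (x $ u - x $ v) else 0) else 0)
      + (\<Sum>v\<in>UNIV. if v = i then (if u = j then \<epsilon> * (x $ u - x $ v) else 0) else 0))"
      unfolding laplacian_mult_nth[OF assms(1)]
        laplacian_mult_nth[OF weighted_multigraph_remove_edges_between[OF assms(1)]]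
        sum.distrib[symmetric]
      by (rule sum.cong) (simp_all add: w[of u] distrib_right)
    also have "\<dots> = (laplacian ?H *v x) $ u
      + ((\<epsilon> * (x $ i - x $ j)) *\<^sub>R (axis i 1 - axis j 1)) $ u"
      using assms(2) by (simp add: axis_def algebra_simps)
    finally show ?thesis .
  qed
  then show ?thesis
    by (simp add: vec_eq_iff \<epsilon>_def)
qed

lemma cumulative_weight_remove_edges_between:
  assumes "\<alpha> > 0" and "weighted_multigraph G" and "i \<noteq> j"
  shows "cumulative_weight \<alpha> G i j
    = cumulative_weight \<alpha> (remove_edges_between G i j) i j + total_weight G i j"
proof -
  let ?H = "remove_edges_between G i j" and ?\<epsilon> = "total_weight G i j"
  let ?d = "axis i 1 - axis j 1 :: real^'a"
  note H = weighted_multigraph_remove_edges_between[OF assms(2), of i j]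
  obtain x where x: "(mat 1 + \<alpha> *\<^sub>R laplacian ?H) *v x = ?d"
    using forest_matrix_solution[OF assms(1) H] .
  define s where "s = x $ i - x $ j"
  \<comment> \<open>The update sends \<open>x\<close> to d + \<alpha> \<epsilon> s d, so
    \<open>c\<close> is the factor by which the solution for \<open>?H\<close> must be divided to
    solve the system for \<open>G\<close>.\<close>
  define c where "c = 1 + \<alpha> * ?\<epsilon> * s"
  have s: "s > 0"
    unfolding s_def by (rule forest_solution_bounds(1)[OF assms(1) H assms(3) x])
  then have c: "c > 0"
    using assms(1) total_weight_nonneg[OF assms(2), of i j]
    by (simp add: c_def add_pos_nonneg)
  have "(mat 1 + \<alpha> *\<^sub>R laplacian G) *v x = c *\<^sub>R ?d"
    using x laplacian_remove_edges_between[OF assms(2,3), of x]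
    by (simp add: forest_matrix_mult c_def s_def scaleR_add_right scaleR_add_left add.assoc[symmetric]
        mult.assoc)
  then have "(mat 1 + \<alpha> *\<^sub>R laplacian G) *v (x /\<^sub>R c) = ?d"
    using c by (simp add: matrix_vector_mult_scaleR)
  from adjusted_forest_distance_eq[OF assms(1,2) this]
  have "adjusted_forest_distance \<alpha> G i j = \<alpha> * s / c"
    by (simp add: s_def divide_inverse algebra_simps)
  moreover have "adjusted_forest_distance \<alpha> ?H i j = \<alpha> * s"
    unfolding s_def by (rule adjusted_forest_distance_eq[OF assms(1) H x])
  \<comment> \<open>The reciprocal distance is c/(\<alpha> s) = 1/(\<alpha> s) + \<epsilon>.\<close>
  ultimately show ?thesis
    using s assms(1) by (simp add: cumulative_weight_def c_def field_simps)
qed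

section \<open>Additivity, the lower bound and the equality case\<close>

theorem proposition6:
  fixes G :: "('n::finite, 'e) wmultigraph" and \<alpha> :: real and i j :: 'n
  assumes "\<alpha> > 0"
    and "weighted_multigraph G"
    and "i \<noteq> j"
  shows "cumulative_weight \<alpha> G i j
           = cumulative_weight \<alpha> (remove_edges_between G i j) i j + total_weight G i j \<and>
         cumulative_weight \<alpha> G i j \<ge> total_weight G i j \<and>
         (cumulative_weight \<alpha> G i j = total_weight G i j
           \<longleftrightarrow> \<not> (\<exists>e\<in>edges G. \<exists>u\<in>{i, j}. \<exists>v. v \<notin> {i, j} \<and> ends G e = {u, v}))"
proof (intro conjI)
  let ?H = "remove_edges_between G i j"
  note H = weighted_multigraph_remove_edges_between[OF assms(2), of i j]
  show eq: "cumulative_weight \<alpha> G i j = cumulative_weight \<alpha> ?H i j + total_weight G i j"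
    by (rule cumulative_weight_remove_edges_between[OF assms])
  show "cumulative_weight \<alpha> G i j \<ge> total_weight G i j"
    using eq cumulative_weight_nonneg(1)[OF assms(1) H assms(3)] by simp
  \<comment> \<open>By additivity, equality means that the cumulative weight in \<open>?H\<close> is
    zero; positive edge weights turn zero totals into empty edge sets.\<close>
  have "cumulative_weight \<alpha> G i j = total_weight G i j \<longleftrightarrow>
      (\<forall>v. edges_between ?H i v = {} \<and> edges_between ?H j v = {})"
    using eq cumulative_weight_nonneg(2)[OF assms(1) H assms(3)]
    by (simp add: total_weight_eq_0_iff[OF H])
  \<comment> \<open>For \<open>v\<close> in \<open>{i, j}\<close> the sets are empty by deletion or
    absence of loops; for other \<open>v\<close> the deletion changes nothing.\<close>
  also have "\<dots> \<longleftrightarrow> (\<forall>u\<in>{i, j}. \<forall>v. v \<notin> {i, j} \<longrightarrow> edges_between G u v = {})"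
  proof -
    have "edges_between G u u = {}" for u
      using assms(2) by (auto simp: edges_between_def weighted_multigraph_def)
    then show ?thesis
      by (auto simp: edges_between_remove_edges_between doubleton_eq_iff)
  qed
  also have "\<dots> \<longleftrightarrow> \<not> (\<exists>e\<in>edges G. \<exists>u\<in>{i, j}. \<exists>v. v \<notin> {i, j} \<and> ends G e = {u, v})"
    by (auto simp: edges_between_def)
  finally show "cumulative_weight \<alpha> G i j = total_weight G i j \<longleftrightarrow>
      \<not> (\<exists>e\<in>edges G. \<exists>u\<in>{i, j}. \<exists>v. v \<notin> {i, j} \<and> ends G e = {u, v})" .
qed

end
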